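(* Let $L$ be a fermentable join-semilattice. Then there exist a family $(L_i)_{i\in I}$ of finite lower bounded lattices and a map $\varphi\colon L\to\prod_{i\in I}L_i$ that is a meet-complete join-embedding; that is, $\varphi$ is an order-embedding, $\varphi(x\vee y)=\varphi(x)\vee\varphi(y)$ for all $x,y\in L$, and whenever $x=\bigwedge_{j\in J}x_j$ holds in $L$ (for $x\in L$ and a family $(x_j)_{j\in J}$ of elements of $L$), the equality $\varphi(x)=\bigwedge_{j\in J}\varphi(x_j)$ holds in $\prod_{i\in I}L_i$.
   Context: Let $S$ be a join-semilattice. Put $S^-=S\setminus\{0\}$ if $S$ has a zero (least) element, and $S^-=S$ otherwise. $\mathrm{J}(S)$ is the set of join-irreducible elements of $S$, i.e. elements of $S^-$ that are not the join of two strictly smaller elements. For $X\subseteq S$, $\downarrow X=\{y\in S\mid \exists x\in X,\ y\leq x\}$; $X$ refines $Y$, written $X\ll Y$, if $X\subseteq\downarrow Y$. For $a\in S^-$: - $\mathcal{C}(a)$ is the set of all finite $X\subseteq S$ with $a\notin\downarrow X$ and $a\leq\bigvee X$ (the nontrivial join-covers of $a$; they are necessarily nonempty); - $\mathcal{M}(a)$ is the set of all $E\in\mathcal{C}(a)$ such that for every $X\in\mathcal{C}(a)$, $X\ll E$ implies $E\subseteq X$; - for $\Sigma\subseteq S$, $\mathcal{M}_\Sigma(a)=\{E\in\mathcal{M}(a)\mid E\subseteq\Sigma\}$. For $\Sigma\subseteq\mathrm{J}(S)$, $S$ has the $\Sigma$-minimal join-cover refinement property ($\Sigma$-MCRP)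 if for every $p\in\Sigma$, every element of $\mathcal{C}(p)$ is refined by some element of $\mathcal{M}_\Sigma(p)$, and $\mathcal{M}_\Sigma(p)$ is finite. The join-dependency relation $D$ on $\mathrm{J}(S)$: $a\mathbin{D}b$ iff $a\neq b$ and there is $c\in S$ such that $a\leq b\vee c$ but $a\nleq x\vee c$ for all $x<b$. An infinite $D$-sequence is a sequence $(a_n)_{n<\omega}$ in $\mathrm{J}(S)$ with $a_n\mathbin{D}a_{n+1}$ for all $n$. A subset $\Sigma\subseteq\mathrm{J}(S)$ is a leaven of $S$ if: (1) $\Sigma$ join-generates $S$, i.e. every element of $S$ is a (possibly infinite or empty) join of elements of $\Sigma$; (2) $S$ satisfies the $\Sigma$-MCRP; (3) there is no infinite $D$-sequence of elements of $\Sigma$. $S$ is fermentable if it has a leaven. A lattice homomorphism $f\colon K\to L$ is lower bounded if the preimage under $f$ of any principal filter of $L$ is either empty or has a least element. A lattice $L$ is lower bounded if every lattice homomorphism from a finitely generated free lattice to $L$ is lower bounded. *)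

theory Defs
  imports "HOL-Algebra.Lattice" "HOL-Library.FuncSet"
begin

section \<open>Join-covers, join-dependency and fermentable join-semilattices\<close>

definition nonzero :: "'a gorder \<Rightarrow> 'a set"
  where "nonzero S = {a \<in> carrier S. \<not> least S a (carrier S)}"

definition join_irreducibles :: "'a gorder \<Rightarrow> 'a set"
  where "join_irreducibles S =
    {a \<in> nonzero S. \<not> (\<exists>x\<in>carrier S. \<exists>y\<in>carrier S.
       x \<sqsubset>\<^bsub>S\<^esub> a \<and> y \<sqsubset>\<^bsub>S\<^esub> a \<and> a = x \<squnion>\<^bsub>S\<^esub> y)}"

definition down :: "'a gorder \<Rightarrow> 'a set \<Rightarrow> 'a set"
  where "down S X = {y \<in> carrier S. \<exists>x\<in>X. y \<sqsubseteq>\<^bsub>S\<^esub> x}"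

definition refines :: "'a gorder \<Rightarrow> 'a set \<Rightarrow> 'a set \<Rightarrow> bool"
  where "refines S X Y \<longleftrightarrow> X \<subseteq> down S Y"

text \<open>
  For \<open>a\<close> in \<open>nonzero S\<close> the empty set is never a join-cover: its join is the zero of \<open>S\<close>,
  if there is one. It is excluded explicitly because \<open>\<Squnion>\<^bsub>S\<^esub>{}\<close> is an arbitrary value if
  \<open>S\<close> has no zero. On finite nonempty subsets of a join-semilattice, \<open>\<Squnion>\<^bsub>S\<^esub>\<close> is
  the actual join.
\<close>

definition join_covers :: "'a gorder \<Rightarrow> 'a \<Rightarrow> 'a set set"
  where "join_covers S a =
    {X. finite X \<and> X \<noteq> {} \<and> X \<subseteq> carrier S \<and> a \<notin> down S X \<and> a \<sqsubseteq>\<^bsub>S\<^esub> \<Squnion>\<^bsub>S\<^esub>X}"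

definition min_join_covers :: "'a gorder \<Rightarrow> 'a \<Rightarrow> 'a set set"
  where "min_join_covers S a =
    {E \<in> join_covers S a. \<forall>X\<in>join_covers S a. refines S X E \<longrightarrow> E \<subseteq> X}"

definition min_join_covers_in :: "'a gorder \<Rightarrow> 'a set \<Rightarrow> 'a \<Rightarrow> 'a set set"
  where "min_join_covers_in S \<Sigma> a = {E \<in> min_join_covers S a. E \<subseteq> \<Sigma>}"

definition MCRP :: "'a gorder \<Rightarrow> 'a set \<Rightarrow> bool"
  where "MCRP S \<Sigma> \<longleftrightarrow>
    (\<forall>p\<in>\<Sigma>. (\<forall>X\<in>join_covers S p. \<exists>E\<in>min_join_covers_in S \<Sigma> p. refines S E X) \<and>
           finite (min_join_covers_in S \<Sigma> p))"

definition join_dep :: "'a gorder \<Rightarrow> 'a \<Rightarrow> 'a \<Rightarrow> bool"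
  where "join_dep S a b \<longleftrightarrow>
    a \<in> join_irreducibles S \<and> b \<in> join_irreducibles S \<and> a \<noteq> b \<and>
    (\<exists>c\<in>carrier S. a \<sqsubseteq>\<^bsub>S\<^esub> b \<squnion>\<^bsub>S\<^esub> c \<and>
       (\<forall>x\<in>carrier S. x \<sqsubset>\<^bsub>S\<^esub> b \<longrightarrow> \<not> a \<sqsubseteq>\<^bsub>S\<^esub> x \<squnion>\<^bsub>S\<^esub> c))"

definition join_generates :: "'a gorder \<Rightarrow> 'a set \<Rightarrow> bool"
  where "join_generates S \<Sigma> \<longleftrightarrow>
    (\<forall>x\<in>carrier S. \<exists>X\<subseteq>\<Sigma>. is_lub S x X)"

definition leaven :: "'a gorder \<Rightarrow> 'a set \<Rightarrow> bool"
  where "leaven S \<Sigma> \<longleftrightarrow>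
    \<Sigma> \<subseteq> join_irreducibles S \<and>
    join_generates S \<Sigma> \<and>
    MCRP S \<Sigma> \<and>
    \<not> (\<exists>a :: nat \<Rightarrow> 'a. \<forall>n. a n \<in> \<Sigma> \<and> join_dep S (a n) (a (Suc n)))"

definition fermentable :: "'a gorder \<Rightarrow> bool"
  where "fermentable S \<longleftrightarrow> (\<exists>\<Sigma>. leaven S \<Sigma>)"


section \<open>Free lattices\<close>

definition lattice_hom :: "'a gorder \<Rightarrow> 'b gorder \<Rightarrow> ('a \<Rightarrow> 'b) \<Rightarrow> bool"
  where "lattice_hom K L f \<longleftrightarrow>
    f \<in> carrier K \<rightarrow> carrier L \<and> join_pres K L f \<and> meet_pres K L f"

text \<open>
  The free lattice on \<open>X\<close> consists of the lattice terms with variables in \<open>X\<close>, modulo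
  provable equality in the theory of lattices. The latter is generated by the least preorder on
  terms for which \<open>Join\<close> and \<open>Meet\<close> yield binary suprema and infima.
\<close>

datatype (lat_vars: 'v) lat_term =
  Var 'v | Join "'v lat_term" "'v lat_term" | Meet "'v lat_term" "'v lat_term"

inductive lat_le :: "'v lat_term \<Rightarrow> 'v lat_term \<Rightarrow> bool" where
  refl: "lat_le t t"
| trans: "lat_le s t \<Longrightarrow> lat_le t u \<Longrightarrow> lat_le s u"
| join_ub1: "lat_le s (Join s t)"
| join_ub2: "lat_le t (Join s t)"
| join_least: "lat_le s u \<Longrightarrow> lat_le t u \<Longrightarrow> lat_le (Join s t) u"
| meet_lb1: "lat_le (Meet s t) s"
| meet_lb2: "lat_le (Meet s t) t"
| meet_greatest: "lat_le u s \<Longrightarrow> lat_le u t \<Longrightarrow> lat_le u (Meet s t)"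

definition lat_terms :: "'v set \<Rightarrow> 'v lat_term set"
  where "lat_terms X = {t. lat_vars t \<subseteq> X}"

definition lat_equiv :: "'v set \<Rightarrow> 'v lat_term rel"
  where "lat_equiv X =
    {(s, t). s \<in> lat_terms X \<and> t \<in> lat_terms X \<and> lat_le s t \<and> lat_le t s}"

definition free_lattice :: "'v set \<Rightarrow> 'v lat_term set gorder"
  where "free_lattice X =
    \<lparr>carrier = lat_terms X // lat_equiv X,
     eq = (=),
     le = (\<lambda>A B. \<exists>s\<in>A. \<exists>t\<in>B. lat_le s t)\<rparr>"

definition free_gen :: "'v set \<Rightarrow> 'v \<Rightarrow> 'v lat_term set"
  where "free_gen X v = lat_equiv X `` {Var v}"

text \<open>\<open>free_lattice X\<close> is a lattice with the universal property over \<open>X\<close>.\<close>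

lemma equiv_lat_equiv: "equiv (lat_terms X) (lat_equiv X)"
proof (rule equivI)
  show "lat_equiv X \<subseteq> lat_terms X \<times> lat_terms X" by (auto simp: lat_equiv_def)
  show "refl_on (lat_terms X) (lat_equiv X)"
    by (auto simp: lat_equiv_def refl_on_def lat_le.refl)
  show "sym (lat_equiv X)" by (auto simp: lat_equiv_def sym_def)
  show "trans (lat_equiv X)"
  proof (rule transI)
    fix s t u assume "(s, t) \<in> lat_equiv X" "(t, u) \<in> lat_equiv X"
    then show "(s, u) \<in> lat_equiv X"
      using lat_le.trans [of s t u] lat_le.trans [of u t s] by (simp add: lat_equiv_def)
  qed
qed

lemma free_lattice_carrierE:
  assumes "A \<in> carrier (free_lattice X)"
  obtains t where "t \<in> lat_terms X" "A = lat_equiv X `` {t}"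
  using assms by (auto simp: free_lattice_def elim: quotientE)

lemma free_lattice_class_closed:
  "t \<in> lat_terms X \<Longrightarrow> lat_equiv X `` {t} \<in> carrier (free_lattice X)"
  by (auto simp: free_lattice_def intro: quotientI)

lemma free_lattice_le_iff:
  assumes "s \<in> lat_terms X" "t \<in> lat_terms X"
  shows "lat_equiv X `` {s} \<sqsubseteq>\<^bsub>free_lattice X\<^esub> lat_equiv X `` {t} \<longleftrightarrow> lat_le s t"
proof
  assume "lat_equiv X `` {s} \<sqsubseteq>\<^bsub>free_lattice X\<^esub> lat_equiv X `` {t}"
  then obtain s' t' where "lat_le s s'" "lat_le s' t'" "lat_le t' t"
    by (auto simp: free_lattice_def lat_equiv_def)
  then show "lat_le s t"
    using lat_le.trans [of s s' t'] lat_le.trans [of s t' t] by simp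
next
  assume "lat_le s t"
  moreover have "s \<in> lat_equiv X `` {s}" "t \<in> lat_equiv X `` {t}"
    using assms by (simp_all add: lat_equiv_def lat_le.refl)
  ultimately show "lat_equiv X `` {s} \<sqsubseteq>\<^bsub>free_lattice X\<^esub> lat_equiv X `` {t}"
    by (auto simp: free_lattice_def)
qed

lemma free_lattice_class_eqI:
  "s \<in> lat_terms X \<Longrightarrow> t \<in> lat_terms X \<Longrightarrow> lat_le s t \<Longrightarrow> lat_le t s \<Longrightarrow>
   lat_equiv X `` {s} = lat_equiv X `` {t}"
  by (rule equiv_class_eq [OF equiv_lat_equiv]) (simp add: lat_equiv_def)

lemma lat_terms_simps [simp]:
  "Var v \<in> lat_terms X \<longleftrightarrow> v \<in> X"
  "Join s t \<in> lat_terms X \<longleftrightarrow> s \<in> lat_terms X \<and> t \<in> lat_terms X"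
  "Meet s t \<in> lat_terms X \<longleftrightarrow> s \<in> lat_terms X \<and> t \<in> lat_terms X"
  by (auto simp: lat_terms_def)

lemma free_lattice_eq: "eq (free_lattice X) = (=)"
  by (simp add: free_lattice_def)

lemma partial_order_free_lattice: "partial_order (free_lattice X)"
proof unfold_locales
  fix A B assume "A \<sqsubseteq>\<^bsub>free_lattice X\<^esub> B" "B \<sqsubseteq>\<^bsub>free_lattice X\<^esub> A"
    "A \<in> carrier (free_lattice X)" "B \<in> carrier (free_lattice X)"
  then show "A .=\<^bsub>free_lattice X\<^esub> B"
  proof (elim free_lattice_carrierE)
    fix s t assume "s \<in> lat_terms X" "A = lat_equiv X `` {s}" "t \<in> lat_terms X"
      "B = lat_equiv X `` {t}" "A \<sqsubseteq>\<^bsub>free_lattice X\<^esub> B" "B \<sqsubseteq>\<^bsub>free_lattice X\<^esub> A"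
    then show ?thesis
      using free_lattice_class_eqI [of s X t] by (simp add: free_lattice_eq free_lattice_le_iff)
  qed
next
  fix A B C assume "A \<sqsubseteq>\<^bsub>free_lattice X\<^esub> B" "B \<sqsubseteq>\<^bsub>free_lattice X\<^esub> C"
    "A \<in> carrier (free_lattice X)" "B \<in> carrier (free_lattice X)" "C \<in> carrier (free_lattice X)"
  then show "A \<sqsubseteq>\<^bsub>free_lattice X\<^esub> C"
  proof (elim free_lattice_carrierE)
    fix s t u assume "s \<in> lat_terms X" "A = lat_equiv X `` {s}" "t \<in> lat_terms X"
      "B = lat_equiv X `` {t}" "u \<in> lat_terms X" "C = lat_equiv X `` {u}"
      "A \<sqsubseteq>\<^bsub>free_lattice X\<^esub> B" "B \<sqsubseteq>\<^bsub>free_lattice X\<^esub> C"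
    then show ?thesis using lat_le.trans [of s t u] by (simp add: free_lattice_le_iff)
  qed
next
  fix A assume "A \<in> carrier (free_lattice X)"
  then show "A \<sqsubseteq>\<^bsub>free_lattice X\<^esub> A"
    by (elim free_lattice_carrierE) (simp add: free_lattice_le_iff lat_le.refl)
qed (simp_all add: free_lattice_eq)

lemma least_Upper_free_lattice:
  assumes "s \<in> lat_terms X" "t \<in> lat_terms X"
  shows "least (free_lattice X) (lat_equiv X `` {Join s t})
    (Upper (free_lattice X) {lat_equiv X `` {s}, lat_equiv X `` {t}})"
    (is "least ?F ?z ?B")
  unfolding least_def
proof (intro conjI ballI)
  show "?B \<subseteq> carrier ?F" by (simp add: Upper_def)
  show "?z \<in> ?B"
    using assms by (simp add: Upper_def free_lattice_class_closed free_lattice_le_iff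
        lat_le.join_ub1 lat_le.join_ub2)
  fix B assume B: "B \<in> ?B"
  then have "B \<in> carrier ?F" by (simp add: Upper_def)
  then obtain u where u: "u \<in> lat_terms X" "B = lat_equiv X `` {u}"
    by (rule free_lattice_carrierE)
  with B assms show "?z \<sqsubseteq>\<^bsub>?F\<^esub> B"
    by (simp add: Upper_def free_lattice_class_closed free_lattice_le_iff lat_le.join_least)
qed

lemma greatest_Lower_free_lattice:
  assumes "s \<in> lat_terms X" "t \<in> lat_terms X"
  shows "greatest (free_lattice X) (lat_equiv X `` {Meet s t})
    (Lower (free_lattice X) {lat_equiv X `` {s}, lat_equiv X `` {t}})"
    (is "greatest ?F ?z ?B")
  unfolding greatest_def
proof (intro conjI ballI)
  show "?B \<subseteq> carrier ?F" by (simp add: Lower_def)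
  show "?z \<in> ?B"
    using assms by (simp add: Lower_def free_lattice_class_closed free_lattice_le_iff
        lat_le.meet_lb1 lat_le.meet_lb2)
  fix B assume B: "B \<in> ?B"
  then have "B \<in> carrier ?F" by (simp add: Lower_def)
  then obtain u where u: "u \<in> lat_terms X" "B = lat_equiv X `` {u}"
    by (rule free_lattice_carrierE)
  with B assms show "B \<sqsubseteq>\<^bsub>?F\<^esub> ?z"
    by (simp add: Lower_def free_lattice_class_closed free_lattice_le_iff lat_le.meet_greatest)
qed

theorem lattice_free_lattice: "lattice (free_lattice X)"
proof -
  interpret partial_order "free_lattice X" by (rule partial_order_free_lattice)
  show ?thesis
  proof unfold_locales
    fix A B assume "A \<in> carrier (free_lattice X)" "B \<in> carrier (free_lattice X)"
    then obtain s t where "s \<in> lat_terms X" "A = lat_equiv X `` {s}"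
      "t \<in> lat_terms X" "B = lat_equiv X `` {t}"
      by (elim free_lattice_carrierE)
    then show "\<exists>S. least (free_lattice X) S (Upper (free_lattice X) {A, B})"
      "\<exists>S. greatest (free_lattice X) S (Lower (free_lattice X) {A, B})"
      using least_Upper_free_lattice greatest_Lower_free_lattice by blast+
  qed
qed

lemma join_eqI:
  assumes "upper_semilattice L" "x \<in> carrier L" "y \<in> carrier L" "least L z (Upper L {x, y})"
  shows "x \<squnion>\<^bsub>L\<^esub> y = z"
proof -
  interpret upper_semilattice L by fact
  show ?thesis using assms(2-4) by (blast intro: joinI [where P = "\<lambda>u. u = z"] least_unique)
qed

lemma meet_eqI:
  assumes "lower_semilattice L" "x \<in> carrier L" "y \<in> carrier L" "greatest L z (Lower L {x, y})"
  shows "x \<sqinter>\<^bsub>L\<^esub> y = z"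
proof -
  interpret lower_semilattice L by fact
  show ?thesis using assms(2-4) by (blast intro: meetI [where P = "\<lambda>u. u = z"] greatest_unique)
qed

lemma free_lattice_join:
  "s \<in> lat_terms X \<Longrightarrow> t \<in> lat_terms X \<Longrightarrow>
   lat_equiv X `` {s} \<squnion>\<^bsub>free_lattice X\<^esub> lat_equiv X `` {t} = lat_equiv X `` {Join s t}"
  by (intro join_eqI lattice.axioms(1) lattice_free_lattice free_lattice_class_closed
      least_Upper_free_lattice)

lemma free_lattice_meet:
  "s \<in> lat_terms X \<Longrightarrow> t \<in> lat_terms X \<Longrightarrow>
   lat_equiv X `` {s} \<sqinter>\<^bsub>free_lattice X\<^esub> lat_equiv X `` {t} = lat_equiv X `` {Meet s t}"
  by (intro meet_eqI lattice.axioms(2) lattice_free_lattice free_lattice_class_closed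
      greatest_Lower_free_lattice)

primrec lat_eval :: "'a gorder \<Rightarrow> ('v \<Rightarrow> 'a) \<Rightarrow> 'v lat_term \<Rightarrow> 'a" where
  "lat_eval L g (Var v) = g v"
| "lat_eval L g (Join s t) = lat_eval L g s \<squnion>\<^bsub>L\<^esub> lat_eval L g t"
| "lat_eval L g (Meet s t) = lat_eval L g s \<sqinter>\<^bsub>L\<^esub> lat_eval L g t"

lemma lat_eval_closed:
  assumes "lattice L" "range g \<subseteq> carrier L"
  shows "lat_eval L g t \<in> carrier L"
proof -
  interpret lattice L by fact
  show ?thesis using assms(2) by (induction t) auto
qed

lemma lat_eval_mono:
  assumes "lattice L" "range g \<subseteq> carrier L" "lat_le s t"
  shows "lat_eval L g s \<sqsubseteq>\<^bsub>L\<^esub> lat_eval L g t"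
proof -
  interpret lattice L by fact
  note [simp] = lat_eval_closed [OF assms(1,2)]
  show ?thesis using assms(3)
  proof (induction rule: lat_le.induct)
    case (trans s t u)
    then show ?case by (meson le_trans lat_eval_closed [OF assms(1,2)])
  qed (simp_all add: join_left join_right join_le meet_left meet_right meet_le)
qed

theorem free_lattice_extension:
  assumes "lattice L" "g \<in> X \<rightarrow> carrier L"
  shows "\<exists>f. lattice_hom (free_lattice X) L f \<and> (\<forall>v\<in>X. f (free_gen X v) = g v)"
proof (cases "X = {}")
  case True
  have "t \<notin> lat_terms X" for t
    using True by (induction t) auto
  then have "carrier (free_lattice X) = {}"
    by (auto elim: free_lattice_carrierE)
  then show ?thesis
    using True assms(1) lattice_free_lattice
    by (auto simp: lattice_hom_def join_pres_def meet_pres_def)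
next
  case False
  then obtain v0 where v0: "v0 \<in> X" by auto
  define h where "h v = (if v \<in> X then g v else g v0)" for v
  have h: "range h \<subseteq> carrier L" using assms(2) v0 by (auto simp: h_def)
  define f where "f A = lat_eval L h (SOME t. t \<in> A)" for A
  interpret lattice L by fact
  have f: "f (lat_equiv X `` {t}) = lat_eval L h t" if "t \<in> lat_terms X" for t
  proof -
    have "t \<in> lat_equiv X `` {t}"
      using that by (auto simp: lat_equiv_def intro: lat_le.refl)
    then have "(SOME s. s \<in> lat_equiv X `` {t}) \<in> lat_equiv X `` {t}"
      by (rule someI)
    then show ?thesis
      unfolding f_def
      by (intro le_antisym lat_eval_mono [OF assms(1) h] lat_eval_closed [OF assms(1) h])
        (auto simp: lat_equiv_def)
  qed
  have "f \<in> carrier (free_lattice X) \<rightarrow> carrier L"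
    using lat_eval_closed [OF assms(1) h] by (auto simp: f_def)
  moreover have "f (A \<squnion>\<^bsub>free_lattice X\<^esub> B) = f A \<squnion>\<^bsub>L\<^esub> f B"
    "f (A \<sqinter>\<^bsub>free_lattice X\<^esub> B) = f A \<sqinter>\<^bsub>L\<^esub> f B"
    if "A \<in> carrier (free_lattice X)" "B \<in> carrier (free_lattice X)" for A B
    using that
    by (elim free_lattice_carrierE, simp add: free_lattice_join free_lattice_meet f)+
  moreover have "f (free_gen X v) = g v" if "v \<in> X" for v
    using that by (simp add: free_gen_def f h_def)
  ultimately have "lattice_hom (free_lattice X) L f \<and> (\<forall>v\<in>X. f (free_gen X v) = g v)"
    using assms(1) lattice_free_lattice by (simp add: lattice_hom_def join_pres_def meet_pres_def)
  then show ?thesis by (intro exI [of _ f])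
qed

theorem free_lattice_hom_unique:
  assumes "lattice_hom (free_lattice X) L f" "lattice_hom (free_lattice X) L f'"
    and "\<And>v. v \<in> X \<Longrightarrow> f (free_gen X v) = f' (free_gen X v)"
    and "A \<in> carrier (free_lattice X)"
  shows "f A = f' A"
proof -
  have "f (lat_equiv X `` {t}) = f' (lat_equiv X `` {t})" if "t \<in> lat_terms X" for t
    using that
  proof (induction t)
    case (Var v)
    then show ?case using assms(3) by (simp add: free_gen_def)
  next
    case (Join s t)
    then show ?case using assms(1,2)
      by (simp add: lattice_hom_def join_pres_def free_lattice_class_closed
          flip: free_lattice_join)
  next
    case (Meet s t)
    then show ?case using assms(1,2)
      by (simp add: lattice_hom_def meet_pres_def free_lattice_class_closed
          flip: free_lattice_meet)
  qed
  then show ?thesis using assms(4) by (elim free_lattice_carrierE) simp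
qed


section \<open>Lower bounded lattices\<close>

definition lower_bounded_hom :: "'a gorder \<Rightarrow> 'b gorder \<Rightarrow> ('a \<Rightarrow> 'b) \<Rightarrow> bool"
  where "lower_bounded_hom K L f \<longleftrightarrow>
    lattice_hom K L f \<and>
    (\<forall>b\<in>carrier L. {x \<in> carrier K. b \<sqsubseteq>\<^bsub>L\<^esub> f x} = {} \<or>
       (\<exists>m. least K m {x \<in> carrier K. b \<sqsubseteq>\<^bsub>L\<^esub> f x}))"

definition lower_bounded_lattice :: "'a gorder \<Rightarrow> bool"
  where "lower_bounded_lattice L \<longleftrightarrow>
    lattice L \<and>
    (\<forall>(n::nat) f. lattice_hom (free_lattice {..<n}) L f \<longrightarrow>
       lower_bounded_hom (free_lattice {..<n}) L f)"


section \<open>Products and meet-complete join-embeddings\<close>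

definition product_gorder :: "'i set \<Rightarrow> ('i \<Rightarrow> 'a gorder) \<Rightarrow> ('i \<Rightarrow> 'a) gorder"
  where "product_gorder I K =
    \<lparr>carrier = (\<Pi>\<^sub>E i\<in>I. carrier (K i)),
     eq = (=),
     le = (\<lambda>f g. \<forall>i\<in>I. f i \<sqsubseteq>\<^bsub>K i\<^esub> g i)\<rparr>"

text \<open>
  Whether \<open>x\<close> is the meet of a family depends only on the underlying set of that family, so
  families are represented by sets. The set \<open>A = {}\<close> is allowed; its meet is the top element.

  HOL cannot quantify existentially over types. In existence statements about families of finite
  lattices, the lattices therefore have carriers in \<^typ>\<open>nat\<close>, which is no restriction up to
  isomorphism. For an embedding of \<open>L\<close> into a product, indices in \<open>'a \<times> 'a\<close> are no
  restriction either: choosing for each pair \<open>(x, y)\<close> with \<open>x\<close> not below \<open>y\<close> one factor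
  in which the images of \<open>x\<close> and \<open>y\<close> witness this gives a subfamily whose product still
  receives such an embedding, since joins and meets in products are computed componentwise.
\<close>

definition meet_complete_join_embedding :: "'a gorder \<Rightarrow> 'b gorder \<Rightarrow> ('a \<Rightarrow> 'b) \<Rightarrow> bool"
  where "meet_complete_join_embedding L P \<phi> \<longleftrightarrow>
    \<phi> \<in> carrier L \<rightarrow> carrier P \<and>
    order_emb L P \<phi> \<and>
    (\<forall>x\<in>carrier L. \<forall>y\<in>carrier L. \<phi> (x \<squnion>\<^bsub>L\<^esub> y) = \<phi> x \<squnion>\<^bsub>P\<^esub> \<phi> y) \<and>
    (\<forall>x A. A \<subseteq> carrier L \<and> is_glb L x A \<longrightarrow> is_glb P (\<phi> x) (\<phi> ` A))"

end

theory Submission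
  imports Defs
begin

text \<open>
  Let \<open>\<Sigma>\<close> be a leaven and \<open>p \<in> \<Sigma>\<close> with \<open>p \<le> x\<close> and \<open>p \<nleq> y\<close>. Members of minimal join-covers of \<open>q\<close>
  are \<open>D\<close>-successors of \<open>q\<close>, so by Koenig's lemma the least \<open>A \<subseteq> \<Sigma>\<close> containing \<open>p\<close> and,
  with each \<open>q\<close>, all \<open>E \<in> \<M>\<^sub>\<Sigma>(q)\<close>, is finite. The subsets of \<open>A\<close> closed under the implications
  \<open>E \<rightarrow> q\<close> for \<open>E \<in> \<M>\<^sub>\<Sigma>(q)\<close> form a finite lattice, which need not consist of lower sets.
  The map \<open>z \<mapsto> A \<inter> \<down>z\<close> into it separates \<open>x\<close> from \<open>y\<close>, preserves meets since they are intersections,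
  and preserves joins by the \<open>\<Sigma>\<close>-MCRP. The lattice is lower bounded since the implications are
  acyclic: least preimages are constructed by recursion along them.
\<close>

section \<open>Finite joins and meets of lattice terms\<close>

lemma finite_term_join:
  assumes "finite T" "T \<noteq> {}" "T \<subseteq> lat_terms X"
  shows "\<exists>m\<in>lat_terms X. (\<forall>t\<in>T. lat_le t m) \<and> (\<forall>u. (\<forall>t\<in>T. lat_le t u) \<longrightarrow> lat_le m u)"
  using assms
proof (induction rule: finite_ne_induct)
  case (singleton t)
  then show ?case by (auto intro: lat_le.refl)
next
  case (insert t T)
  then obtain m where "m \<in> lat_terms X" "\<forall>t\<in>T. lat_le t m"
    "\<forall>u. (\<forall>t\<in>T. lat_le t u) \<longrightarrow> lat_le m u" by auto
  then show ?case using insert.prems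
    by (intro bexI [of _ "Join t m"])
      (auto intro: lat_le.join_ub1 lat_le.join_least lat_le.trans [OF _ lat_le.join_ub2])
qed

text \<open>The property \<open>P\<close> travels through the induction because the lower bound
  itself must have it: in \<open>least_term_containing\<close>, \<open>P\<close> says that
  \<open>q\<close> lies in the value of the term.\<close>

lemma finite_term_meet:
  assumes "finite T" "T \<noteq> {}" "T \<subseteq> lat_terms X" "\<And>t. t \<in> T \<Longrightarrow> P t"
    and "\<And>s t. s \<in> lat_terms X \<Longrightarrow> t \<in> lat_terms X \<Longrightarrow> P s \<Longrightarrow> P t \<Longrightarrow> P (Meet s t)"
  shows "\<exists>m\<in>lat_terms X. (\<forall>t\<in>T. lat_le m t) \<and> P m"
  using assms(1-4)
proof (induction rule: finite_ne_induct)
  case (singleton t)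
  then show ?case by (auto intro: lat_le.refl)
next
  case (insert t T)
  then obtain m where "m \<in> lat_terms X" "\<forall>t\<in>T. lat_le m t" "P m" by auto
  then show ?case using insert.prems assms(5)
    by (intro bexI [of _ "Meet t m"])
      (auto intro: lat_le.meet_lb1 lat_le.trans [OF lat_le.meet_lb2])
qed

text \<open>The meet of the finitely many variables lies below each variable, hence below every
  term. This settles the empty set \<open>B\<close> in \<open>least_term_containing\<close>; without
  variables there are no terms at all.\<close>

lemma least_lat_term:
  assumes "finite X" "lat_terms X \<noteq> {}"
  shows "\<exists>m\<in>lat_terms X. \<forall>t\<in>lat_terms X. lat_le m t"
proof -
  have "X \<noteq> {}"
  proof
    assume "X = {}"
    then have "t \<notin> lat_terms X" for t by (induction t) auto
    with assms(2) show False by auto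
  qed
  then have "\<exists>m\<in>lat_terms X. \<forall>t\<in>Var ` X. lat_le m t"
    using finite_term_meet [of "Var ` X" X "\<lambda>_. True"] assms(1) by (simp add: image_subset_iff)
  then obtain m where m: "m \<in> lat_terms X" "\<And>v. v \<in> X \<Longrightarrow> lat_le m (Var v)"
    by auto
  have "lat_le m t" if "t \<in> lat_terms X" for t
    using that
  proof (induction t)
    case (Join s t)
    then show ?case using lat_le.trans [OF _ lat_le.join_ub1] by simp
  qed (simp_all add: m lat_le.meet_greatest)
  with m(1) show ?thesis by blast
qed

text \<open>
  The least term valued above \<open>q\<close> is the meet of all generators valued above \<open>q\<close> and of the
  joins, over the sets \<open>E\<close> that force \<open>q\<close>, of the least terms valued above the members of \<open>E\<close>.
\<close>

lemma least_term_containing: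
  assumes "finite A" "finite X" "wf {(r, q). \<exists>E\<in>cov q. r \<in> E}"
    and val: "\<And>t. t \<in> lat_terms X \<Longrightarrow> val t \<subseteq> A"
    and mono: "\<And>s t. s \<in> lat_terms X \<Longrightarrow> t \<in> lat_terms X \<Longrightarrow> lat_le s t \<Longrightarrow> val s \<subseteq> val t"
    and meet: "\<And>s t. s \<in> lat_terms X \<Longrightarrow> t \<in> lat_terms X \<Longrightarrow> val s \<inter> val t \<subseteq> val (Meet s t)"
    and join: "\<And>q s t. s \<in> lat_terms X \<Longrightarrow> t \<in> lat_terms X \<Longrightarrow> q \<in> val (Join s t) \<Longrightarrow>
      q \<in> val s \<or> q \<in> val t \<or> (\<exists>E\<in>cov q. E \<subseteq> val (Join s t))"
    and closed: "\<And>q E t. q \<in> A \<Longrightarrow> E \<in> cov q \<Longrightarrow> t \<in> lat_terms X \<Longrightarrow> E \<subseteq> val t \<Longrightarrow> q \<in> val t"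
    and B: "B \<subseteq> A" "t \<in> lat_terms X" "B \<subseteq> val t"
  shows "\<exists>m\<in>lat_terms X. B \<subseteq> val m \<and> (\<forall>t\<in>lat_terms X. B \<subseteq> val t \<longrightarrow> lat_le m t)"
proof -
  \<comment> \<open>The definition is conditional on some term having a value above
    \<open>B\<close>, so that the induction can run over all of \<open>A\<close>, including elements
    that no term reaches.\<close>
  define has_least where "has_least B \<longleftrightarrow> (\<forall>t\<in>lat_terms X. B \<subseteq> val t \<longrightarrow>
    (\<exists>m\<in>lat_terms X. B \<subseteq> val m \<and> (\<forall>t\<in>lat_terms X. B \<subseteq> val t \<longrightarrow> lat_le m t)))" for B
  \<comment> \<open>The join of the least terms for the members of \<open>B\<close> is the least
    term for \<open>B\<close>.\<close>
  have sets: "has_least B" if B: "B \<subseteq> A" and sing: "\<And>q. q \<in> B \<Longrightarrow> has_least {q}" for B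
    unfolding has_least_def
  proof (intro ballI impI)
    fix t assume t: "t \<in> lat_terms X" "B \<subseteq> val t"
    show "\<exists>m\<in>lat_terms X. B \<subseteq> val m \<and> (\<forall>t\<in>lat_terms X. B \<subseteq> val t \<longrightarrow> lat_le m t)"
    proof (cases "B = {}")
      case True
      then show ?thesis using least_lat_term [OF assms(2)] t by auto
    next
      case False
      have "\<exists>m\<in>lat_terms X. q \<in> val m \<and> (\<forall>t\<in>lat_terms X. q \<in> val t \<longrightarrow> lat_le m t)"
        if "q \<in> B" for q
        using sing [OF that] t that by (auto simp: has_least_def)
      then obtain \<beta> where \<beta>: "\<And>q. q \<in> B \<Longrightarrow> \<beta> q \<in> lat_terms X"
        "\<And>q. q \<in> B \<Longrightarrow> q \<in> val (\<beta> q)"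
        "\<And>q t. q \<in> B \<Longrightarrow> t \<in> lat_terms X \<Longrightarrow> q \<in> val t \<Longrightarrow> lat_le (\<beta> q) t"
        by metis
      have "finite (\<beta> ` B)" using B assms(1) finite_subset by auto
      then have "\<exists>m\<in>lat_terms X. (\<forall>t\<in>\<beta> ` B. lat_le t m) \<and>
        (\<forall>u. (\<forall>t\<in>\<beta> ` B. lat_le t u) \<longrightarrow> lat_le m u)"
        using False \<beta>(1) by (intro finite_term_join) auto
      then obtain m where m: "m \<in> lat_terms X" "\<forall>q\<in>B. lat_le (\<beta> q) m"
        "\<forall>u. (\<forall>q\<in>B. lat_le (\<beta> q) u) \<longrightarrow> lat_le m u"
        by (simp only: ball_simps) blast
      show ?thesis
      proof (intro bexI conjI ballI impI)
        show "B \<subseteq> val m" using mono \<beta>(1,2) m(1,2) by blast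
        show "lat_le m u" if "u \<in> lat_terms X" "B \<subseteq> val u" for u
          using m(3) \<beta>(3) that by blast
      qed (fact m(1))
    qed
  qed
  have sing: "has_least {q}" if "q \<in> A" for q
    using assms(3) that
  proof (induction q)
    case (less q)
    \<comment> \<open>Only premises contained in the value of some term have a least term
      \<open>\<beta> E\<close>. Such premises are subsets of the finite set \<open>A\<close>, which
      makes \<open>Es\<close> finite.\<close>
    define Es where "Es = {E \<in> cov q. \<exists>t\<in>lat_terms X. E \<subseteq> val t}"
    have "\<exists>m\<in>lat_terms X. E \<subseteq> val m \<and> (\<forall>t\<in>lat_terms X. E \<subseteq> val t \<longrightarrow> lat_le m t)"
      if E: "E \<in> Es" for E
    proof -
      have "E \<subseteq> A" using E val by (auto simp: Es_def)
      moreover have "has_least {r}" if "r \<in> E" for r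
        using less.IH [of r] that E \<open>E \<subseteq> A\<close> by (auto simp: Es_def)
      ultimately have "has_least E" by (rule sets)
      then show ?thesis using E by (auto simp: Es_def has_least_def)
    qed
    then obtain \<beta> where \<beta>: "\<And>E. E \<in> Es \<Longrightarrow> \<beta> E \<in> lat_terms X"
      "\<And>E. E \<in> Es \<Longrightarrow> E \<subseteq> val (\<beta> E)"
      "\<And>E t. E \<in> Es \<Longrightarrow> t \<in> lat_terms X \<Longrightarrow> E \<subseteq> val t \<Longrightarrow> lat_le (\<beta> E) t"
      by metis
    define T where "T = {Var v |v. v \<in> X \<and> q \<in> val (Var v)} \<union> \<beta> ` Es"
    have "Es \<subseteq> Pow A" using val by (auto simp: Es_def)
    then have "finite T"
      using assms(1,2) by (auto simp: T_def finite_subset)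
    have "q \<in> val (\<beta> E)" if "E \<in> Es" for E
      using closed [OF \<open>q \<in> A\<close> _ \<beta>(1) [OF that] \<beta>(2) [OF that]] that by (simp add: Es_def)
    then have T: "t \<in> lat_terms X" "q \<in> val t" if "t \<in> T" for t
      using that \<beta>(1) by (auto simp: T_def)
    \<comment> \<open>Induction on \<open>t\<close> shows that a lower bound of \<open>T\<close> is
      below every term whose value contains \<open>q\<close>. At a join where neither argument
      contains \<open>q\<close>, some premise \<open>E\<close> lies in the value of the join, so
      \<open>\<beta> E\<close> is below it. Nonemptiness of \<open>T\<close> is proved alongside,
      since the meet of \<open>T\<close> is taken next.\<close>
    have le: "T \<noteq> {} \<and> (\<forall>u. (\<forall>w\<in>T. lat_le u w) \<longrightarrow> lat_le u t)"
      if "t \<in> lat_terms X" "q \<in> val t" for t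
      using that
    proof (induction t)
      case (Var v)
      then have "Var v \<in> T" by (auto simp: T_def)
      then show ?case by auto
    next
      case (Meet s t)
      then have "q \<in> val s" "q \<in> val t"
        using mono [OF _ _ lat_le.meet_lb1, of s t] mono [OF _ _ lat_le.meet_lb2, of s t] by auto
      then show ?case using Meet by (auto intro: lat_le.meet_greatest)
    next
      case (Join s t)
      consider "q \<in> val s" | "q \<in> val t" | E where "E \<in> cov q" "E \<subseteq> val (Join s t)"
        using join [of s t q] Join.prems by auto
      then show ?case
      proof cases
        case 1
        then have "T \<noteq> {}" "\<And>u. \<forall>w\<in>T. lat_le u w \<Longrightarrow> lat_le u s" using Join by auto
        then show ?thesis using lat_le.trans [OF _ lat_le.join_ub1] by blast
      next
        case 2
        then have "T \<noteq> {}" "\<And>u. \<forall>w\<in>T. lat_le u w \<Longrightarrow> lat_le u t" using Join by auto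
        then show ?thesis using lat_le.trans [OF _ lat_le.join_ub2] by blast
      next
        case 3
        then have E: "E \<in> Es" using Join.prems by (auto simp: Es_def)
        then have "\<beta> E \<in> T" "lat_le (\<beta> E) (Join s t)"
          using \<beta>(3) [OF E Join.prems(1)] 3 by (auto simp: T_def)
        then show ?thesis using lat_le.trans [of _ "\<beta> E" "Join s t"] by blast
      qed
    qed
    show ?case
      unfolding has_least_def
    proof (intro ballI impI)
      fix t assume "t \<in> lat_terms X" "{q} \<subseteq> val t"
      then have "T \<noteq> {}" using le by auto
      then have "\<exists>m\<in>lat_terms X. (\<forall>t\<in>T. lat_le m t) \<and> q \<in> val m"
        using \<open>finite T\<close> T subsetD [OF meet] by (intro finite_term_meet) auto
      then obtain m where "m \<in> lat_terms X" "\<forall>t\<in>T. lat_le m t" "q \<in> val m" by blast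
      then show "\<exists>m\<in>lat_terms X. {q} \<subseteq> val m \<and> (\<forall>t\<in>lat_terms X. {q} \<subseteq> val t \<longrightarrow> lat_le m t)"
        using le by blast
    qed
  qed
  have "has_least B" using sets [OF B(1)] sing B(1) by blast
  then show ?thesis using B(2,3) by (auto simp: has_least_def)
qed


section \<open>Lattices of closed sets of acyclic implications\<close>

definition closed_sets :: "'b set \<Rightarrow> ('b \<Rightarrow> 'b set set) \<Rightarrow> 'b set set"
  where "closed_sets A cov = {X. X \<subseteq> A \<and> (\<forall>q\<in>A. \<forall>E\<in>cov q. E \<subseteq> X \<longrightarrow> q \<in> X)}"

definition hull_in :: "'b set set \<Rightarrow> 'b set \<Rightarrow> 'b set"
  where "hull_in C Y = \<Inter>{X \<in> C. Y \<subseteq> X}"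

text \<open>The code \<open>e\<close> is there to move a finite lattice of sets to a carrier of natural numbers.\<close>

definition coded_inclusion :: "'b set set \<Rightarrow> ('b set \<Rightarrow> 'c) \<Rightarrow> 'c gorder"
  where "coded_inclusion C e =
    \<lparr>carrier = e ` C, eq = (=), le = (\<lambda>m n. inv_into C e m \<subseteq> inv_into C e n)\<rparr>"

locale acyclic_implications =
  fixes A :: "'b set" and cov :: "'b \<Rightarrow> 'b set set" and e :: "'b set \<Rightarrow> 'c"
  assumes finite_base: "finite A"
    and inj_code: "inj_on e (closed_sets A cov)"
    and wf_cov: "wf {(r, q). \<exists>E\<in>cov q. r \<in> E}"
begin

abbreviation "C \<equiv> closed_sets A cov"
abbreviation "K \<equiv> coded_inclusion C e"

lemma closed_subset: "X \<in> C \<Longrightarrow> X \<subseteq> A"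
  by (simp add: closed_sets_def)

lemma finite_carrier: "finite (carrier K)"
proof -
  have "C \<subseteq> Pow A" by (auto simp: closed_sets_def)
  then show ?thesis using finite_base by (auto simp: coded_inclusion_def finite_subset)
qed

lemma closed_Int: "X \<in> C \<Longrightarrow> Y \<in> C \<Longrightarrow> X \<inter> Y \<in> C"
  by (auto simp: closed_sets_def)

text \<open>The set \<open>A\<close> itself is closed, so for \<open>Y \<subseteq> A\<close> the
  intersection is over a nonempty family and stays inside \<open>A\<close>.\<close>

lemma hull_closed: "Y \<subseteq> A \<Longrightarrow> hull_in C Y \<in> C"
  unfolding hull_in_def closed_sets_def by blast

lemma hull_extensive: "Y \<subseteq> hull_in C Y"
  by (auto simp: hull_in_def)

lemma hull_minimal: "Y \<subseteq> X \<Longrightarrow> X \<in> C \<Longrightarrow> hull_in C Y \<subseteq> X"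
  by (auto simp: hull_in_def)

text \<open>Adding to \<open>Y\<close> all conclusions of implications with premise inside the hull
  gives a set \<open>Z\<close> within the hull. A premise inside \<open>Z\<close> is then inside the
  hull, so \<open>Z\<close> is closed and equals the hull.\<close>

lemma hull_cases:
  assumes "Y \<subseteq> A" "q \<in> hull_in C Y"
  shows "q \<in> Y \<or> (\<exists>E\<in>cov q. E \<subseteq> hull_in C Y)"
proof -
  define H where "H = hull_in C Y"
  define Z where "Z = Y \<union> {q \<in> A. \<exists>E\<in>cov q. E \<subseteq> H}"
  have "H \<in> C" "Y \<subseteq> H"
    using hull_closed [OF assms(1)] hull_extensive by (simp_all add: H_def)
  then have "Z \<subseteq> H" by (auto simp: Z_def closed_sets_def)
  moreover have "Z \<subseteq> A" using assms(1) by (auto simp: Z_def)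
  ultimately have "Z \<in> C" unfolding closed_sets_def Z_def by blast
  then have "H \<subseteq> Z" unfolding H_def by (intro hull_minimal) (simp_all add: Z_def)
  then have "q \<in> Z" using assms(2) by (auto simp: H_def)
  then show ?thesis by (auto simp: Z_def H_def)
qed

section \<open>Order, joins and meets of the coded lattice of closed sets\<close>

lemma code_le_iff: "X \<in> C \<Longrightarrow> Y \<in> C \<Longrightarrow> e X \<sqsubseteq>\<^bsub>K\<^esub> e Y \<longleftrightarrow> X \<subseteq> Y"
  by (simp add: coded_inclusion_def inj_code)

lemma code_closed: "X \<in> C \<Longrightarrow> e X \<in> carrier K"
  by (simp add: coded_inclusion_def)

lemma carrierE:
  assumes "m \<in> carrier K"
  obtains X where "X \<in> C" "m = e X"
  using assms by (auto simp: coded_inclusion_def)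

lemma partial_order_coded: "partial_order K"
  by unfold_locales (auto simp: coded_inclusion_def inj_code)

lemma lub_coded:
  assumes "X \<in> C" "Y \<in> C"
  shows "is_lub K (e (hull_in C (X \<union> Y))) {e X, e Y}"
proof -
  have sub: "X \<union> Y \<subseteq> A" using assms closed_subset by auto
  show ?thesis
  proof (rule least_UpperI)
    fix m assume m: "m \<in> Upper K {e X, e Y}"
    then have "m \<in> carrier K" by (simp add: Upper_def)
    then obtain Z where Z: "Z \<in> C" "m = e Z" by (rule carrierE)
    with m assms have "X \<subseteq> Z" "Y \<subseteq> Z"
      by (auto simp: Upper_def code_closed code_le_iff)
    then show "e (hull_in C (X \<union> Y)) \<sqsubseteq>\<^bsub>K\<^esub> m"
      using Z hull_minimal by (simp add: code_le_iff hull_closed [OF sub])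
  qed (use assms hull_extensive [of "X \<union> Y"] in
      \<open>auto simp: code_le_iff code_closed hull_closed [OF sub]\<close>)
qed

text \<open>The meet \<open>X\<close> is described by its order properties and not as
  \<open>\<Inter>F\<close>: for empty \<open>F\<close> the latter is the whole type, whereas the top
  closed set is \<open>A\<close>.\<close>

lemma glb_family_coded:
  assumes "X \<in> C" "F \<subseteq> C" "\<And>Y. Y \<in> F \<Longrightarrow> X \<subseteq> Y"
    and greatest: "\<And>Z. Z \<in> C \<Longrightarrow> (\<And>Y. Y \<in> F \<Longrightarrow> Z \<subseteq> Y) \<Longrightarrow> Z \<subseteq> X"
  shows "is_glb K (e X) (e ` F)"
proof (rule greatest_LowerI)
  fix m assume m: "m \<in> Lower K (e ` F)"
  then have "m \<in> carrier K" by (simp add: Lower_def)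
  then obtain Z where Z: "Z \<in> C" "m = e Z" by (rule carrierE)
  have "Z \<subseteq> Y" if "Y \<in> F" for Y
  proof -
    have "Y \<in> C" using that assms(2) by auto
    moreover have "e Z \<sqsubseteq>\<^bsub>K\<^esub> e Y"
      using m Z that code_closed [OF \<open>Y \<in> C\<close>] by (auto simp: Lower_def)
    ultimately show ?thesis using Z by (simp add: code_le_iff)
  qed
  then show "m \<sqsubseteq>\<^bsub>K\<^esub> e X"
    using Z assms(1) greatest by (simp add: code_le_iff)
next
  show "e X \<sqsubseteq>\<^bsub>K\<^esub> m" if "m \<in> e ` F" for m
  proof -
    from that obtain Y where "Y \<in> F" "m = e Y" by blast
    then show ?thesis
      using code_le_iff [OF assms(1) subsetD [OF assms(2) \<open>Y \<in> F\<close>]] assms(3) by simp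
  qed
  show "e ` F \<subseteq> carrier K" using assms(2) code_closed by blast
  show "e X \<in> carrier K" using assms(1) by (rule code_closed)
qed

lemma glb_coded: "X \<in> C \<Longrightarrow> Y \<in> C \<Longrightarrow> is_glb K (e (X \<inter> Y)) {e X, e Y}"
  using glb_family_coded [of "X \<inter> Y" "{X, Y}"] closed_Int by auto

lemma lattice_coded: "lattice K"
proof -
  interpret partial_order K by (rule partial_order_coded)
  show ?thesis
  proof unfold_locales
    fix m n assume "m \<in> carrier K" "n \<in> carrier K"
    then obtain X Y where "X \<in> C" "m = e X" "Y \<in> C" "n = e Y" by (elim carrierE)
    then show "\<exists>s. least K s (Upper K {m, n})" "\<exists>s. greatest K s (Lower K {m, n})"
      using lub_coded glb_coded by blast+
  qed
qed

lemma join_coded: "X \<in> C \<Longrightarrow> Y \<in> C \<Longrightarrow> e X \<squnion>\<^bsub>K\<^esub> e Y = e (hull_in C (X \<union> Y))"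
  by (intro join_eqI lattice.axioms(1) lattice_coded code_closed lub_coded)

lemma meet_coded: "X \<in> C \<Longrightarrow> Y \<in> C \<Longrightarrow> e X \<sqinter>\<^bsub>K\<^esub> e Y = e (X \<inter> Y)"
  by (intro meet_eqI lattice.axioms(2) lattice_coded code_closed glb_coded)

text \<open>The value of a term is the closed set whose code is the image of its class. The preimage
  of the filter above \<open>e B\<close> then consists of the classes of terms with value containing
  \<open>B\<close>, and \<open>least_term_containing\<close> gives the least one.\<close>

theorem lower_bounded_hom_coded:
  assumes "finite V" and hom: "lattice_hom (free_lattice V) K f"
  shows "lower_bounded_hom (free_lattice V) K f"
proof -
  let ?F = "free_lattice V"
  define cls where "cls t = lat_equiv V `` {t}" for t
  define val where "val t = inv_into C e (f (cls t))" for t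
  have cls: "cls t \<in> carrier ?F" if "t \<in> lat_terms V" for t
    using that by (simp add: cls_def free_lattice_class_closed)
  have f_cls: "f (cls t) = e (val t)" and val: "val t \<in> C" if "t \<in> lat_terms V" for t
  proof -
    have "f (cls t) \<in> e ` C"
      using hom cls [OF that] by (auto simp: lattice_hom_def coded_inclusion_def)
    then show "f (cls t) = e (val t)" "val t \<in> C"
      by (simp_all add: val_def f_inv_into_f inv_into_into)
  qed
  have val_Join: "val (Join s t) = hull_in C (val s \<union> val t)"
    if "s \<in> lat_terms V" "t \<in> lat_terms V" for s t
  proof -
    have "e (val (Join s t)) = e (val s) \<squnion>\<^bsub>K\<^esub> e (val t)"
      using hom that
      by (simp add: lattice_hom_def join_pres_def cls_def free_lattice_class_closed
          flip: f_cls free_lattice_join)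
    also have "\<dots> = e (hull_in C (val s \<union> val t))"
      using that by (simp add: join_coded val)
    finally show ?thesis
      by (rule inj_onD [OF inj_code]) (use that val in \<open>simp_all add: hull_closed closed_subset\<close>)
  qed
  have val_Meet: "val (Meet s t) = val s \<inter> val t"
    if "s \<in> lat_terms V" "t \<in> lat_terms V" for s t
  proof -
    have "e (val (Meet s t)) = e (val s) \<sqinter>\<^bsub>K\<^esub> e (val t)"
      using hom that
      by (simp add: lattice_hom_def meet_pres_def cls_def free_lattice_class_closed
          flip: f_cls free_lattice_meet)
    also have "\<dots> = e (val s \<inter> val t)"
      using that by (simp add: meet_coded val)
    finally show ?thesis
      by (rule inj_onD [OF inj_code]) (use that val in \<open>simp_all add: closed_Int\<close>)
  qed
  \<comment> \<open>Monotonicity comes from join preservation: if \<open>lat_le s t\<close>, then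
    \<open>Join s t\<close> and \<open>t\<close> have the same class.\<close>
  have mono: "val s \<subseteq> val t" if "s \<in> lat_terms V" "t \<in> lat_terms V" "lat_le s t" for s t
  proof -
    have "cls (Join s t) = cls t"
      unfolding cls_def using that
      by (intro free_lattice_class_eqI) (auto intro: lat_le.intros)
    then have "val t = hull_in C (val s \<union> val t)"
      using val_Join [OF that(1,2)] by (simp add: val_def)
    then show ?thesis using hull_extensive by blast
  qed
  have le_iff: "e B \<sqsubseteq>\<^bsub>K\<^esub> f (cls t) \<longleftrightarrow> B \<subseteq> val t" if "B \<in> C" "t \<in> lat_terms V" for B t
    using that by (simp add: f_cls val code_le_iff)
  have "\<exists>m. least ?F m {x \<in> carrier ?F. b \<sqsubseteq>\<^bsub>K\<^esub> f x}"
    if "b \<in> carrier K" and ne: "{x \<in> carrier ?F. b \<sqsubseteq>\<^bsub>K\<^esub> f x} \<noteq> {}" for b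
  proof -
    obtain B where B: "B \<in> C" "b = e B" using \<open>b \<in> carrier K\<close> by (rule carrierE)
    obtain t where t: "t \<in> lat_terms V" "B \<subseteq> val t"
      using ne B le_iff by (auto simp: cls_def elim!: free_lattice_carrierE)
    have "\<exists>m\<in>lat_terms V. B \<subseteq> val m \<and> (\<forall>t\<in>lat_terms V. B \<subseteq> val t \<longrightarrow> lat_le m t)"
    proof (rule least_term_containing [where val = val and B = B and t = t,
          OF finite_base assms(1) wf_cov])
      \<comment> \<open>The value of a join is a hull, so \<open>hull_cases\<close> gives the join
        condition.\<close>
      fix q s t assume st: "s \<in> lat_terms V" "t \<in> lat_terms V" "q \<in> val (Join s t)"
      then show "q \<in> val s \<or> q \<in> val t \<or> (\<exists>E\<in>cov q. E \<subseteq> val (Join s t))"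
        using hull_cases [of "val s \<union> val t" q] closed_subset val by (auto simp: val_Join)
    next
      fix q E t assume "q \<in> A" "E \<in> cov q" "t \<in> lat_terms V" "E \<subseteq> val t"
      then show "q \<in> val t" using val [of t] by (auto simp: closed_sets_def)
    next
      show "B \<subseteq> A" using B(1) by (rule closed_subset)
    qed (use t mono val closed_subset val_Meet in simp_all)
    then obtain m where "m \<in> lat_terms V" "B \<subseteq> val m"
      "\<And>t. t \<in> lat_terms V \<Longrightarrow> B \<subseteq> val t \<Longrightarrow> lat_le m t" by blast
    then have "least ?F (cls m) {x \<in> carrier ?F. b \<sqsubseteq>\<^bsub>K\<^esub> f x}"
      unfolding least_def using B le_iff cls
      by (auto simp: cls_def free_lattice_le_iff elim!: free_lattice_carrierE)
    then show ?thesis ..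
  qed
  then show ?thesis using hom by (auto simp: lower_bounded_hom_def)
qed

lemma lower_bounded_lattice_coded: "lower_bounded_lattice K"
  by (simp add: lower_bounded_lattice_def lattice_coded lower_bounded_hom_coded)

end


section \<open>Minimal join-covers and the join-dependency relation\<close>

text \<open>
  In \<^locale>\<open>upper_semilattice\<close> the order may be an extension of the record type \<open>gorder\<close>; the
  notions of join-cover and join-dependency are only defined on \<open>gorder\<close> itself.
\<close>

locale plain_semilattice = upper_semilattice L for L :: "'a gorder" (structure)

text \<open>The witness \<open>c\<close> is the join of the other members of \<open>E\<close>. If
  some \<open>x\<close> strictly below \<open>q\<close> satisfied
  \<open>p \<sqsubseteq> x \<squnion> c\<close>, replacing \<open>q\<close> by \<open>x\<close> in
  \<open>E\<close> would give a cover of \<open>p\<close> that refines \<open>E\<close> but omits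
  \<open>q\<close>, against minimality.\<close>

lemma (in plain_semilattice) min_join_cover_imp_join_dep:
  assumes "E \<in> min_join_covers L p" "q \<in> E"
    and "p \<in> join_irreducibles L" "q \<in> join_irreducibles L"
  shows "join_dep L p q"
proof -
  have E: "finite E" "E \<subseteq> carrier L" "p \<notin> down L E" "p \<sqsubseteq> \<Squnion>E"
    and min: "\<And>X. X \<in> join_covers L p \<Longrightarrow> refines L X E \<Longrightarrow> E \<subseteq> X"
    using assms(1) by (auto simp: min_join_covers_def join_covers_def)
  have p: "p \<in> carrier L" using assms(3) by (simp add: join_irreducibles_def nonzero_def)
  have q: "q \<in> carrier L" using E(2) assms(2) by auto
  let ?E = "E - {q}"
  \<comment> \<open>A cover \<open>{q}\<close> would put \<open>p\<close> below \<open>q\<close>.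
    Nonemptiness makes \<open>\<Squnion>?E\<close> an actual join even if \<open>L\<close> has no
    zero.\<close>
  have "?E \<noteq> {}"
  proof
    assume "?E = {}"
    then have "E = {q}" using assms(2) by auto
    then have "\<Squnion>E \<sqsubseteq> q"
      using q by (intro least_le [OF finite_sup_least] Upper_memI) auto
    then have "p \<sqsubseteq> q" using le_trans [OF E(4)] E(1,2) \<open>E = {q}\<close> p q by auto
    then show False using E(3) p assms(2) by (auto simp: down_def)
  qed
  then have lub: "is_lub L (\<Squnion>?E) ?E"
    using E by (intro finite_sup_least) auto
  let ?c = "\<Squnion>?E"
  have c: "?c \<in> carrier L" using lub by simp
  \<comment> \<open>This is used with \<open>z = q\<close>, where the set is \<open>E\<close>, and
    with \<open>z = x\<close>, the replacement for \<open>q\<close>.\<close>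
  have sup: "\<Squnion>(insert z ?E) = z \<squnion> ?c" if z: "z \<in> carrier L" for z
  proof (rule sup_insertI [OF _ lub z])
    fix s assume s: "is_lub L s (insert z ?E)"
    show "s = z \<squnion> ?c"
    proof (rule le_antisym)
      have "y \<sqsubseteq> z \<squnion> ?c" if "y \<in> ?E" for y
        using least_Upper_above [OF lub that] join_right [OF z c] that E(2) z c
        by (meson DiffD1 Diff_subset join_closed le_trans subset_eq)
      then show "s \<sqsubseteq> z \<squnion> ?c"
        using z c by (intro least_le [OF s] Upper_memI) (auto intro: join_left)
      have above: "y \<sqsubseteq> s" if "y \<in> insert z ?E" for y
        using that z E(2) by (intro least_Upper_above [OF s]) auto
      then have "z \<sqsubseteq> s" by blast
      moreover have "?c \<sqsubseteq> s"
        using above least_closed [OF s] by (intro least_le [OF lub] Upper_memI) blast+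
      ultimately show "z \<squnion> ?c \<sqsubseteq> s" using z c least_closed [OF s] by (intro join_le)
    qed (use z c least_closed [OF s] in auto)
  qed (use E(2) in auto)
  have "p \<sqsubseteq> q \<squnion> ?c"
    using sup [OF q] E(4) assms(2) by (simp add: insert_absorb)
  moreover have "\<not> p \<sqsubseteq> x \<squnion> ?c" if x: "x \<in> carrier L" "x \<sqsubset> q" for x
  proof
    assume "p \<sqsubseteq> x \<squnion> ?c"
    have xq: "x \<sqsubseteq> q" "x \<noteq> q" using x(2) by (auto simp: lless_def eq_is_equal)
    let ?X = "insert x ?E"
    have "y \<in> down L E" if "y \<in> E" for y
      using that subsetD [OF E(2) that] unfolding down_def by blast
    then have ref: "refines L ?X E"
      using x xq assms(2) by (auto simp: refines_def down_def)
    have "p \<notin> down L ?X"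
    proof
      assume "p \<in> down L ?X"
      then have "p \<sqsubseteq> x \<or> (\<exists>y\<in>E. p \<sqsubseteq> y)" by (auto simp: down_def)
      then have "\<exists>y\<in>E. p \<sqsubseteq> y"
        using le_trans [of p x q] xq(1) p q x(1) assms(2) by auto
      then show False using E(3) p by (auto simp: down_def)
    qed
    then have "?X \<in> join_covers L p"
      using \<open>p \<sqsubseteq> x \<squnion> ?c\<close> E x by (auto simp: join_covers_def sup)
    then have "E \<subseteq> ?X" using ref by (rule min)
    then show False using assms(2) xq(2) by auto
  qed
  moreover have "p \<noteq> q"
    using E(3) p assms(2) by (auto simp: down_def)
  ultimately show ?thesis
    using assms(3,4) c by (auto simp: join_dep_def)
qed

text \<open>This is Koenig's lemma by well-founded induction: what is reachable from
  \<open>x\<close> is \<open>x\<close> together with the finitely many finite sets reachable from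
  its successors.\<close>

lemma finite_rtrancl_Image:
  assumes "wf (R\<inverse>)" "\<And>x. finite (R `` {x})"
  shows "finite (R\<^sup>* `` {x})"
  using assms(1)
proof (induction x)
  case (less x)
  have "R\<^sup>* `` {x} = insert x (\<Union>y\<in>R `` {x}. R\<^sup>* `` {y})"
    by (auto intro: converse_rtrancl_into_rtrancl elim: converse_rtranclE)
  then show ?case using less assms(2) by auto
qed

text \<open>The conjunct \<open>q \<in> \<Sigma>\<close> leaves elements outside
  \<open>\<Sigma>\<close> without covers, so that the membership relation of covers is well-founded
  on the whole type.\<close>

definition leaven_covers :: "'a gorder \<Rightarrow> 'a set \<Rightarrow> 'a \<Rightarrow> 'a set set"
  where "leaven_covers L \<Sigma> q = {E \<in> min_join_covers_in L \<Sigma> q. q \<in> \<Sigma>}"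

text \<open>An infinite descending chain would be an infinite \<open>D\<close>-sequence in
  \<open>\<Sigma>\<close>, by \<open>min_join_cover_imp_join_dep\<close>.\<close>

lemma (in plain_semilattice) wf_leaven_covers:
  assumes "leaven L \<Sigma>"
  shows "wf {(r, q). \<exists>E\<in>leaven_covers L \<Sigma> q. r \<in> E}" (is "wf ?R")
proof -
  have "q \<in> \<Sigma> \<and> join_dep L q r" if "(r, q) \<in> ?R" for r q
    using that assms min_join_cover_imp_join_dep [of _ q r]
    by (auto simp: leaven_covers_def min_join_covers_in_def leaven_def)
  then show ?thesis
    using assms unfolding wf_iff_no_infinite_down_chain leaven_def by blast
qed

lemma (in plain_semilattice) finite_cover_closed_set:
  assumes "leaven L \<Sigma>" "p \<in> \<Sigma>"
  shows "\<exists>A. finite A \<and> A \<subseteq> \<Sigma> \<and> p \<in> A \<and> (\<forall>q\<in>A. \<forall>E\<in>leaven_covers L \<Sigma> q. E \<subseteq> A)"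
proof -
  define R where "R = {(q, r). \<exists>E\<in>leaven_covers L \<Sigma> q. r \<in> E}"
  have "R\<inverse> = {(r, q). \<exists>E\<in>leaven_covers L \<Sigma> q. r \<in> E}" by (auto simp: R_def)
  then have "wf (R\<inverse>)" using wf_leaven_covers [OF assms(1)] by simp
  \<comment> \<open>Branching is finite: the \<open>\<Sigma>\<close>-MCRP leaves finitely many
    minimal covers, each of them a finite set.\<close>
  moreover have "finite (R `` {q})" for q
  proof -
    have "finite (leaven_covers L \<Sigma> q)"
      using assms(1) by (cases "q \<in> \<Sigma>") (auto simp: leaven_covers_def leaven_def MCRP_def)
    moreover have "finite E" if "E \<in> leaven_covers L \<Sigma> q" for E
      using that
      by (auto simp: leaven_covers_def min_join_covers_in_def min_join_covers_def join_covers_def)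
    moreover have "R `` {q} = \<Union>(leaven_covers L \<Sigma> q)" by (auto simp: R_def)
    ultimately show ?thesis by auto
  qed
  ultimately have "finite (R\<^sup>* `` {p})" by (rule finite_rtrancl_Image)
  moreover have "R\<^sup>* `` {p} \<subseteq> \<Sigma>"
  proof
    fix q assume "q \<in> R\<^sup>* `` {p}"
    then have "(p, q) \<in> R\<^sup>*" by auto
    then show "q \<in> \<Sigma>"
      by (induction rule: rtrancl_induct)
        (use assms(2) in \<open>auto simp: R_def leaven_covers_def min_join_covers_in_def\<close>)
  qed
  moreover have "E \<subseteq> R\<^sup>* `` {p}" if "q \<in> R\<^sup>* `` {p}" "E \<in> leaven_covers L \<Sigma> q" for q E
    using that by (auto simp: R_def intro: rtrancl_into_rtrancl)
  ultimately show ?thesis by (intro exI [of _ "R\<^sup>* `` {p}"]) auto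
qed

section \<open>Separation by a leaven, and traces of principal lower sets\<close>

lemma leaven_in_carrier: "leaven L \<Sigma> \<Longrightarrow> \<Sigma> \<subseteq> carrier L"
  by (auto simp: leaven_def join_irreducibles_def nonzero_def)

lemma (in plain_semilattice) leaven_separates:
  assumes "leaven L \<Sigma>" "x \<in> carrier L" "y \<in> carrier L" "\<not> x \<sqsubseteq> y"
  shows "\<exists>p\<in>\<Sigma>. p \<sqsubseteq> x \<and> \<not> p \<sqsubseteq> y"
proof -
  obtain X where X: "X \<subseteq> \<Sigma>" "is_lub L x X"
    using assms(1,2) unfolding leaven_def join_generates_def by blast
  have "X \<subseteq> carrier L" using X(1) leaven_in_carrier [OF assms(1)] by simp
  have "\<exists>p\<in>X. \<not> p \<sqsubseteq> y"
  proof (rule ccontr)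
    assume "\<not> ?thesis"
    then have "x \<sqsubseteq> y" using assms(3) by (intro least_le [OF X(2)] Upper_memI) auto
    with assms(4) show False ..
  qed
  then show ?thesis using X least_Upper_above [OF X(2) _ \<open>X \<subseteq> carrier L\<close>] by blast
qed

definition trace :: "'a gorder \<Rightarrow> 'a set \<Rightarrow> 'a \<Rightarrow> 'a set"
  where "trace L A z = {q \<in> A. q \<sqsubseteq>\<^bsub>L\<^esub> z}"

lemma (in plain_semilattice) trace_mono:
  assumes "A \<subseteq> carrier L" "x \<in> carrier L" "y \<in> carrier L" "x \<sqsubseteq> y"
  shows "trace L A x \<subseteq> trace L A y"
  using assms le_trans [of _ x y] by (auto simp: trace_def)

text \<open>If all members of a cover of \<open>q\<close> lie below \<open>z\<close>, so does their
  join, and hence so does \<open>q\<close>.\<close>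

lemma (in plain_semilattice) trace_closed:
  assumes "A \<subseteq> carrier L" "z \<in> carrier L"
  shows "trace L A z \<in> closed_sets A (leaven_covers L \<Sigma>)"
proof -
  have "q \<sqsubseteq> z" if q: "q \<in> A" "E \<in> leaven_covers L \<Sigma> q" "E \<subseteq> trace L A z" for q E
  proof -
    have E: "finite E" "E \<noteq> {}" "E \<subseteq> carrier L" "q \<sqsubseteq> \<Squnion>E"
      using q(2)
      by (auto simp: leaven_covers_def min_join_covers_in_def min_join_covers_def join_covers_def)
    then have "\<Squnion>E \<sqsubseteq> z"
      using q(3) assms(2)
      by (intro least_le [OF finite_sup_least] Upper_memI) (auto simp: trace_def)
    then show ?thesis using le_trans [of q "\<Squnion>E" z] E q(1) assms by auto
  qed
  then show ?thesis by (auto simp: closed_sets_def trace_def)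
qed

text \<open>If \<open>q\<close> is below \<open>x \<squnion> y\<close> but below neither
  \<open>x\<close> nor \<open>y\<close>, then \<open>{x, y}\<close> is a nontrivial cover of
  \<open>q\<close>, and the \<open>\<Sigma>\<close>-MCRP refines it to a minimal one,
  \<open>E\<close>. As \<open>A\<close> contains \<open>E\<close>, each member of \<open>E\<close>
  is in one of the two traces, so \<open>E\<close> forces \<open>q\<close> into the hull.\<close>

lemma (in plain_semilattice) trace_join:
  assumes leaven: "leaven L \<Sigma>" and A: "A \<subseteq> \<Sigma>" "\<And>q E. q \<in> A \<Longrightarrow> E \<in> leaven_covers L \<Sigma> q \<Longrightarrow> E \<subseteq> A"
    and x: "x \<in> carrier L" and y: "y \<in> carrier L"
  shows "trace L A (x \<squnion> y) =
    hull_in (closed_sets A (leaven_covers L \<Sigma>)) (trace L A x \<union> trace L A y)"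
    (is "_ = hull_in ?C ?Y")
proof
  have carr: "A \<subseteq> carrier L" using A(1) leaven_in_carrier [OF leaven] by simp
  have "trace L A x \<subseteq> trace L A (x \<squnion> y)" "trace L A y \<subseteq> trace L A (x \<squnion> y)"
    using x y by (simp_all add: trace_mono [OF carr] join_left join_right)
  then show "hull_in ?C ?Y \<subseteq> trace L A (x \<squnion> y)"
    using trace_closed [OF carr join_closed [OF x y]] by (auto simp: hull_in_def)
  show "trace L A (x \<squnion> y) \<subseteq> hull_in ?C ?Y"
  proof
    fix q assume "q \<in> trace L A (x \<squnion> y)"
    then have q: "q \<in> A" "q \<sqsubseteq> x \<squnion> y" by (auto simp: trace_def)
    show "q \<in> hull_in ?C ?Y"
    proof (cases "q \<sqsubseteq> x \<or> q \<sqsubseteq> y")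
      case True
      then show ?thesis using q(1) by (auto simp: hull_in_def trace_def)
    next
      case False
      then have "{x, y} \<in> join_covers L q"
        using x y q(2) by (auto simp: join_covers_def down_def join_def)
      then obtain E where E: "E \<in> leaven_covers L \<Sigma> q" "refines L E {x, y}"
        using leaven q(1) A(1) unfolding leaven_def MCRP_def leaven_covers_def by blast
      then have "E \<subseteq> ?Y"
        using A(2) [OF q(1) E(1)] by (auto simp: refines_def down_def trace_def)
      then show ?thesis using E(1) q(1) by (fastforce simp: hull_in_def closed_sets_def)
    qed
  qed
qed


section \<open>Embedding into the product\<close>

lemma partial_order_product:
  assumes "\<And>i. i \<in> I \<Longrightarrow> partial_order (K i)"
  shows "partial_order (product_gorder I K)"
proof unfold_locales
  show "(.=\<^bsub>product_gorder I K\<^esub>) = (=)" by (simp add: product_gorder_def)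
next
  fix f assume "f \<in> carrier (product_gorder I K)"
  then show "f \<sqsubseteq>\<^bsub>product_gorder I K\<^esub> f"
    using assms[THEN partial_order.axioms(1), THEN weak_partial_order.le_refl]
    by (auto simp: product_gorder_def)
next
  fix f g assume fg: "f \<sqsubseteq>\<^bsub>product_gorder I K\<^esub> g" "g \<sqsubseteq>\<^bsub>product_gorder I K\<^esub> f"
    "f \<in> carrier (product_gorder I K)" "g \<in> carrier (product_gorder I K)"
  then have "f = g"
    by (intro PiE_ext [of f I "\<lambda>i. carrier (K i)" g])
      (auto simp: product_gorder_def intro!: partial_order.le_antisym [OF assms])
  then show "f .=\<^bsub>product_gorder I K\<^esub> g" by (simp add: product_gorder_def)
next
  fix f g h assume "f \<sqsubseteq>\<^bsub>product_gorder I K\<^esub> g" "g \<sqsubseteq>\<^bsub>product_gorder I K\<^esub> h"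
    "f \<in> carrier (product_gorder I K)" "g \<in> carrier (product_gorder I K)"
    "h \<in> carrier (product_gorder I K)"
  then show "f \<sqsubseteq>\<^bsub>product_gorder I K\<^esub> h"
    using assms[THEN partial_order.axioms(1), THEN weak_partial_order.le_trans]
    by (fastforce simp: product_gorder_def)
qed (auto simp: product_gorder_def)

lemma lub_product:
  assumes "f \<in> carrier (product_gorder I K)" "g \<in> carrier (product_gorder I K)"
    and "s \<in> carrier (product_gorder I K)"
    and lub: "\<And>i. i \<in> I \<Longrightarrow> is_lub (K i) (s i) {f i, g i}"
  shows "is_lub (product_gorder I K) s {f, g}"
proof (rule least_UpperI)
  have fg: "f i \<in> carrier (K i)" "g i \<in> carrier (K i)" if "i \<in> I" for i
    using assms(1,2) that by (auto simp: product_gorder_def)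
  show "h \<sqsubseteq>\<^bsub>product_gorder I K\<^esub> s" if "h \<in> {f, g}" for h
    using that least_Upper_above [OF lub] fg by (auto simp: product_gorder_def)
  show "s \<sqsubseteq>\<^bsub>product_gorder I K\<^esub> h" if h: "h \<in> Upper (product_gorder I K) {f, g}" for h
  proof -
    have "s i \<sqsubseteq>\<^bsub>K i\<^esub> h i" if "i \<in> I" for i
      using h assms(1,2) that
      by (intro least_le [OF lub [OF that]]) (auto simp: product_gorder_def Upper_def)
    then show ?thesis by (simp add: product_gorder_def)
  qed
qed (use assms in auto)

lemma glb_product:
  assumes F: "F \<subseteq> carrier (product_gorder I K)" and "s \<in> carrier (product_gorder I K)"
    and glb: "\<And>i. i \<in> I \<Longrightarrow> is_glb (K i) (s i) ((\<lambda>f. f i) ` F)"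
  shows "is_glb (product_gorder I K) s F"
proof (rule greatest_LowerI)
  have F_i: "(\<lambda>f. f i) ` F \<subseteq> carrier (K i)" if "i \<in> I" for i
    using F that by (auto simp: product_gorder_def)
  show "s \<sqsubseteq>\<^bsub>product_gorder I K\<^esub> f" if "f \<in> F" for f
    using greatest_Lower_below [OF glb _ F_i] that by (auto simp: product_gorder_def)
  show "h \<sqsubseteq>\<^bsub>product_gorder I K\<^esub> s" if h: "h \<in> Lower (product_gorder I K) F" for h
  proof -
    have "h i \<sqsubseteq>\<^bsub>K i\<^esub> s i" if "i \<in> I" for i
      using h F that
      by (intro greatest_le [OF glb [OF that]]) (auto simp: product_gorder_def Lower_def)
    then show ?thesis by (simp add: product_gorder_def)
  qed
qed (use assms in auto)

theorem theorem5p2: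
  fixes L :: "'a gorder"
  assumes "upper_semilattice L"
    and "fermentable L"
  shows "\<exists>(I :: ('a \<times> 'a) set) (K :: 'a \<times> 'a \<Rightarrow> nat gorder) \<phi>.
    (\<forall>i\<in>I. finite (carrier (K i)) \<and> lower_bounded_lattice (K i)) \<and>
    meet_complete_join_embedding L (product_gorder I K) \<phi>"
proof -
  interpret plain_semilattice L by (rule plain_semilattice.intro) fact
  obtain \<Sigma> where \<Sigma>: "leaven L \<Sigma>" using assms(2) by (auto simp: fermentable_def)
  \<comment> \<open>There is one factor for each pair violating the order, and that factor has to
    tell the pair apart.\<close>
  define I where "I = {(x, y). x \<in> carrier L \<and> y \<in> carrier L \<and> \<not> x \<sqsubseteq>\<^bsub>L\<^esub> y}"
  have "\<exists>A. finite A \<and> A \<subseteq> \<Sigma> \<and> (\<forall>q\<in>A. \<forall>E\<in>leaven_covers L \<Sigma> q. E \<subseteq> A) \<and>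
    \<not> trace L A (fst i) \<subseteq> trace L A (snd i)" if i: "i \<in> I" for i
  proof -
    obtain p where p: "p \<in> \<Sigma>" "p \<sqsubseteq>\<^bsub>L\<^esub> fst i" "\<not> p \<sqsubseteq>\<^bsub>L\<^esub> snd i"
      using leaven_separates [OF \<Sigma>, of "fst i" "snd i"] i by (auto simp: I_def)
    obtain A where A: "finite A" "A \<subseteq> \<Sigma>" "p \<in> A" "\<forall>q\<in>A. \<forall>E\<in>leaven_covers L \<Sigma> q. E \<subseteq> A"
      using finite_cover_closed_set [OF \<Sigma> p(1)] by blast
    have "p \<in> trace L A (fst i)" "p \<notin> trace L A (snd i)"
      using p A(3) by (simp_all add: trace_def)
    with A show ?thesis by blast
  qed
  then obtain A where A: "\<And>i. i \<in> I \<Longrightarrow> finite (A i)" "\<And>i. i \<in> I \<Longrightarrow> A i \<subseteq> \<Sigma>"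
    "\<And>i q E. i \<in> I \<Longrightarrow> q \<in> A i \<Longrightarrow> E \<in> leaven_covers L \<Sigma> q \<Longrightarrow> E \<subseteq> A i"
    "\<And>i. i \<in> I \<Longrightarrow> \<not> trace L (A i) (fst i) \<subseteq> trace L (A i) (snd i)"
    by metis
  define C where "C i = closed_sets (A i) (leaven_covers L \<Sigma>)" for i
  \<comment> \<open>Each lattice of closed sets is finite, so its elements can be coded by natural
    numbers.\<close>
  have "\<exists>e :: 'a set \<Rightarrow> nat. inj_on e (C i)" if "i \<in> I" for i
  proof -
    have "C i \<subseteq> Pow (A i)" by (auto simp: C_def closed_sets_def)
    then have "finite (C i)" using A(1) [OF that] by (auto intro: finite_subset)
    then show ?thesis using finite_imp_inj_to_nat_seg by metis
  qed
  then obtain e :: "'a \<times> 'a \<Rightarrow> 'a set \<Rightarrow> nat" where e: "\<And>i. i \<in> I \<Longrightarrow> inj_on (e i) (C i)"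
    by metis
  define K where "K i = coded_inclusion (C i) (e i)" for i
  have ai: "acyclic_implications (A i) (leaven_covers L \<Sigma>) (e i)" if "i \<in> I" for i
    using A(1) e wf_leaven_covers [OF \<Sigma>] that by unfold_locales (auto simp: C_def)
  note K_eq = K_def [unfolded C_def]
  \<comment> \<open>Restriction to \<open>I\<close> makes \<open>\<phi> z\<close> extensional, as
    members of the product carrier are.\<close>
  define \<phi> where "\<phi> z = (\<lambda>i\<in>I. e i (trace L (A i) z))" for z
  let ?P = "product_gorder I K"
  have A_carrier: "A i \<subseteq> carrier L" if "i \<in> I" for i
    using A(2) that leaven_in_carrier [OF \<Sigma>] by blast
  have trace: "trace L (A i) z \<in> C i" if "i \<in> I" "z \<in> carrier L" for i z
    unfolding C_def using that A_carrier by (intro trace_closed)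
  have \<phi>: "\<phi> z \<in> carrier ?P" if "z \<in> carrier L" for z
    using trace that by (auto simp: \<phi>_def product_gorder_def K_def coded_inclusion_def)
  have po: "partial_order ?P"
    using acyclic_implications.partial_order_coded [OF ai]
    by (intro partial_order_product) (simp add: K_eq)
  have le: "\<phi> x \<sqsubseteq>\<^bsub>?P\<^esub> \<phi> y \<longleftrightarrow> (\<forall>i\<in>I. trace L (A i) x \<subseteq> trace L (A i) y)"
    if "x \<in> carrier L" "y \<in> carrier L" for x y
    using acyclic_implications.code_le_iff [OF ai] trace that
    by (simp add: product_gorder_def \<phi>_def K_eq C_def)
  have emb: "order_emb L ?P \<phi>"
    unfolding order_emb_def
  proof (intro conjI ballI iffI)
    show "weak_partial_order L" by (rule weak_partial_order_axioms)
    show "weak_partial_order ?P" using po by (rule partial_order.axioms)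
    fix x y assume xy: "x \<in> carrier L" "y \<in> carrier L"
    show "\<phi> x \<sqsubseteq>\<^bsub>?P\<^esub> \<phi> y" if "x \<sqsubseteq>\<^bsub>L\<^esub> y"
      using that xy trace_mono [OF A_carrier] by (simp add: le)
    show "x \<sqsubseteq>\<^bsub>L\<^esub> y" if "\<phi> x \<sqsubseteq>\<^bsub>?P\<^esub> \<phi> y"
    proof (rule ccontr)
      \<comment> \<open>The factor indexed by \<open>(x, y)\<close> itself gives the
        contradiction.\<close>
      assume "\<not> x \<sqsubseteq>\<^bsub>L\<^esub> y"
      then have "(x, y) \<in> I" using xy by (simp add: I_def)
      then show False using that xy A(4) [of "(x, y)"] by (auto simp: le)
    qed
  qed
  have join: "\<phi> (x \<squnion>\<^bsub>L\<^esub> y) = \<phi> x \<squnion>\<^bsub>?P\<^esub> \<phi> y" if xy: "x \<in> carrier L" "y \<in> carrier L" for x y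
  proof -
    have "is_lub (K i) (\<phi> (x \<squnion>\<^bsub>L\<^esub> y) i) {\<phi> x i, \<phi> y i}" if i: "i \<in> I" for i
      using acyclic_implications.lub_coded [OF ai [OF i] trace [OF i xy(1), unfolded C_def]
          trace [OF i xy(2), unfolded C_def]]
        trace_join [OF \<Sigma> A(2,3) xy, of i] i
      by (simp add: \<phi>_def K_eq)
    then have "is_lub ?P (\<phi> (x \<squnion>\<^bsub>L\<^esub> y)) {\<phi> x, \<phi> y}"
      using \<phi> xy by (intro lub_product) auto
    then show ?thesis
      \<comment> \<open>The join in the product is a chosen least upper bound; antisymmetry
        identifies it with the one just found.\<close>
      unfolding join_def [of ?P] sup_def
      by (intro some_equality [symmetric] partial_order.least_unique [OF po])
  qed
  have meet: "is_glb ?P (\<phi> x) (\<phi> ` B)" if B: "B \<subseteq> carrier L" "is_glb L x B" for x B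
  proof (rule glb_product)
    fix i assume i: "i \<in> I"
    have x: "x \<in> carrier L" using B(2) by simp
    have "is_glb (K i) (e i (trace L (A i) x)) (e i ` trace L (A i) ` B)"
      unfolding K_eq
    proof (rule acyclic_implications.glb_family_coded [OF ai [OF i]])
      show "trace L (A i) x \<subseteq> Y" if "Y \<in> trace L (A i) ` B" for Y
      proof -
        from that obtain z where z: "z \<in> B" "Y = trace L (A i) z" by blast
        then have "x \<sqsubseteq>\<^bsub>L\<^esub> z" "z \<in> carrier L"
          using greatest_Lower_below [OF B(2) _ B(1)] B(1) by auto
        then show ?thesis using x z(2) by (simp add: trace_mono [OF A_carrier [OF i]])
      qed
      \<comment> \<open>An element of \<open>A i\<close> below every member of \<open>B\<close> is
        below the meet \<open>x\<close>. For empty \<open>B\<close>, \<open>x\<close> is the top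
        element and its trace is all of \<open>A i\<close>.\<close>
      show "Z \<subseteq> trace L (A i) x"
        if Z: "Z \<in> closed_sets (A i) (leaven_covers L \<Sigma>)"
          "\<And>Y. Y \<in> trace L (A i) ` B \<Longrightarrow> Z \<subseteq> Y" for Z
      proof
        fix q assume "q \<in> Z"
        then have "q \<in> A i" "\<And>z. z \<in> B \<Longrightarrow> q \<sqsubseteq>\<^bsub>L\<^esub> z"
          using Z by (auto simp: closed_sets_def trace_def)
        moreover from this have "q \<sqsubseteq>\<^bsub>L\<^esub> x"
          using A_carrier [OF i] by (intro greatest_le [OF B(2)] Lower_memI) auto
        ultimately show "q \<in> trace L (A i) x" by (simp add: trace_def)
      qed
    qed (use trace [OF i] B x in \<open>auto simp: C_def\<close>)
    then show "is_glb (K i) (\<phi> x i) ((\<lambda>f. f i) ` \<phi> ` B)"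
      using i by (simp add: \<phi>_def image_image)
  qed (use \<phi> B in auto)
  have "meet_complete_join_embedding L ?P \<phi>"
    using \<phi> emb join meet by (auto simp: meet_complete_join_embedding_def)
  moreover have "finite (carrier (K i)) \<and> lower_bounded_lattice (K i)" if "i \<in> I" for i
    unfolding K_eq using acyclic_implications.finite_carrier [OF ai [OF that]]
      acyclic_implications.lower_bounded_lattice_coded [OF ai [OF that]] by simp
  ultimately show ?thesis by blast
qed

end
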